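(* For every integer $d\geq 1$ let $x,y\in\mathbb{R}^d$ be drawn independently at random with respect to the spherical Gaussian distribution with zero mean and unit variance. Then: (i) for every $\epsilon>18$ there exists $d_0\in\mathbb{N}$ such that for all $d\geq d_0$: $\ \mathrm{P}\bigl[\,\bigl|\|x-y\|-\sqrt{2d}\,\bigr|\geq\epsilon\,\bigr]\leq \frac{18}{\epsilon}$; (ii) for every $\epsilon>18$ and every $d\geq\epsilon^2$: $\ \mathrm{P}\bigl[\,\bigl|\|x-y\|-\sqrt{2d}\,\bigr|\geq\epsilon\,\bigr]\leq \frac{18}{\epsilon}+\frac{8}{\sqrt{d}}$.
   Context: The spherical Gaussian distribution on $\mathbb{R}^d$ with zero mean and unit variance has density $(2\pi)^{-d/2}\exp(-\|x\|^2/2)$ with respect to Lebesgue measure. $\|\cdot\|$ is the Euclidean norm. *)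

theory Defs
  imports "HOL-Probability.Probability"
begin

text \<open>
  The dimension is quantified inside the theorem, so \<open>\<real>\<^sup>d\<close> is represented by the real functions
  on the index set \<open>{..<d}\<close>, extended by \<open>undefined\<close> outside it as usual for \<^const>\<open>Pi\<^sub>M\<close>.
  The Euclidean norm of \<open>x\<close> is \<^term>\<open>L2_set x {..<d}\<close>.
\<close>

definition lborel_pow :: "nat \<Rightarrow> (nat \<Rightarrow> real) measure" where
  "lborel_pow d = (\<Pi>\<^sub>M i\<in>{..<d}. lborel)"

definition std_gaussian_density :: "nat \<Rightarrow> (nat \<Rightarrow> real) \<Rightarrow> real" where
  "std_gaussian_density d x =
     (2 * pi) powr (- real d / 2) * exp (- (L2_set x {..<d})\<^sup>2 / 2)"

definition indep_std_gaussians ::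
  "'a measure \<Rightarrow> nat \<Rightarrow> ('a \<Rightarrow> nat \<Rightarrow> real) \<Rightarrow> ('a \<Rightarrow> nat \<Rightarrow> real) \<Rightarrow> bool" where
  "indep_std_gaussians M d X Y \<longleftrightarrow>
     prob_space M \<and>
     distributed M (lborel_pow d) X (\<lambda>x. ennreal (std_gaussian_density d x)) \<and>
     distributed M (lborel_pow d) Y (\<lambda>x. ennreal (std_gaussian_density d x)) \<and>
     prob_space.indep_var M (lborel_pow d) X (lborel_pow d) Y"

end

theory Submission
  imports Defs
begin

text \<open>
  The idea is to apply the second moment method to the squared distance, which is a polynomial in
  the coordinates, rather than to the distance itself. Put \<open>R = \<parallel>X - Y\<parallel>\<close>, \<open>s = \<surd>(2d)\<close> and
  \<open>D = R\<^sup>2 - s\<^sup>2\<close>. Since \<open>D = (R - s)(R + s)\<close> and \<open>R + s \<ge> s\<close>, a deviation \<open>\<bar>R - s\<bar> \<ge> \<epsilon>\<close> forces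
  \<open>\<bar>D\<bar> \<ge> \<epsilon>s\<close>, an event of probability at most \<open>E[D\<^sup>2] / (2d\<epsilon>\<^sup>2)\<close>. The dimension cancels as soon as
  \<open>E[D\<^sup>2]\<close> is linear in \<open>d\<close>.

  To see that it is, expand the square: \<open>D = A + B - 2C\<close> with \<open>A = \<parallel>X\<parallel>\<^sup>2 - d\<close>, \<open>B = \<parallel>Y\<parallel>\<^sup>2 - d\<close> and \<open>C\<close> the
  inner product of \<open>X\<close> and \<open>Y\<close>. Each of the three is a sum of \<open>d\<close> pairwise orthogonal terms,
  \<open>X\<^sub>i\<^sup>2 - 1\<close>, \<open>Y\<^sub>i\<^sup>2 - 1\<close> and \<open>X\<^sub>iY\<^sub>i\<close>, whose second moments are \<open>2\<close>, \<open>2\<close> and \<open>1\<close>; hence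
  (\<open>second_moment_sum_orthogonal\<close>) \<open>E[A\<^sup>2] = E[B\<^sup>2] = 2d\<close> and \<open>E[C\<^sup>2] = d\<close>. With
  \<open>(A + B - 2C)\<^sup>2 \<le> 3(A\<^sup>2 + B\<^sup>2 + 4C\<^sup>2)\<close> this gives \<open>E[D\<^sup>2] \<le> 24d\<close>. (The exact value is \<open>8d\<close>, but the
  cruder bound spares the mixed moments of \<open>A\<close>, \<open>B\<close> and \<open>C\<close>.)

  So the probability is at most \<open>12/\<epsilon>\<^sup>2\<close> in every dimension
  (\<open>std_gaussian_distance_concentration\<close>), which for \<open>\<epsilon> > 18\<close> is far below \<open>18/\<epsilon>\<close>. Both parts
  follow, the first with \<open>d\<^sub>0 = 0\<close>. The orthogonality rests on the coordinates of a Gaussian vector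
  being independent standard normal variables (\<open>std_gaussian_coordinates\<close>), which holds because its
  density is a product of one-dimensional densities.
\<close>

section \<open>Sums of orthogonal random variables\<close>

text \<open>
  Pythagoras in \<open>L\<^sup>2\<close>: only the diagonal of the expanded square survives the expectation. With
  this, pairwise information about the summands suffices.
\<close>

lemma (in prob_space) second_moment_sum_orthogonal:
  fixes W :: "'i \<Rightarrow> 'a \<Rightarrow> real"
  assumes int: "\<And>i j. i \<in> I \<Longrightarrow> j \<in> I \<Longrightarrow> integrable M (\<lambda>\<omega>. W i \<omega> * W j \<omega>)"
    and fin: "finite I"
    and orth: "\<And>i j. i \<in> I \<Longrightarrow> j \<in> I \<Longrightarrow> i \<noteq> j \<Longrightarrow> expectation (\<lambda>\<omega>. W i \<omega> * W j \<omega>) = 0"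
  shows "integrable M (\<lambda>\<omega>. (\<Sum>i\<in>I. W i \<omega>)\<^sup>2)"
    and "expectation (\<lambda>\<omega>. (\<Sum>i\<in>I. W i \<omega>)\<^sup>2) = (\<Sum>i\<in>I. expectation (\<lambda>\<omega>. (W i \<omega>)\<^sup>2))"
proof -
  have sq: "(\<Sum>i\<in>I. W i \<omega>)\<^sup>2 = (\<Sum>i\<in>I. \<Sum>j\<in>I. W i \<omega> * W j \<omega>)" for \<omega>
    by (simp add: power2_eq_square sum_product)
  show "integrable M (\<lambda>\<omega>. (\<Sum>i\<in>I. W i \<omega>)\<^sup>2)"
    unfolding sq using int by auto
  have "expectation (\<lambda>\<omega>. (\<Sum>i\<in>I. W i \<omega>)\<^sup>2)
      = (\<Sum>i\<in>I. \<Sum>j\<in>I. expectation (\<lambda>\<omega>. W i \<omega> * W j \<omega>))"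
    unfolding sq using int by (simp add: Bochner_Integration.integral_sum)
  also have "\<dots> = (\<Sum>i\<in>I. \<Sum>j\<in>I. if j = i then expectation (\<lambda>\<omega>. (W i \<omega>)\<^sup>2) else 0)"
    using orth by (intro sum.cong refl) (auto simp: power2_eq_square)
  also have "\<dots> = (\<Sum>i\<in>I. expectation (\<lambda>\<omega>. (W i \<omega>)\<^sup>2))"
    using fin by simp
  finally show "expectation (\<lambda>\<omega>. (\<Sum>i\<in>I. W i \<omega>)\<^sup>2) = (\<Sum>i\<in>I. expectation (\<lambda>\<omega>. (W i \<omega>)\<^sup>2))" .
qed

lemma (in prob_space)
  fixes Z :: "'i \<Rightarrow> 'a \<Rightarrow> real"
  assumes ind: "indep_vars (\<lambda>_. borel) Z I"
    and int: "\<And>i. i \<in> I \<Longrightarrow> integrable M (Z i)"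
    and ij: "i \<in> I" "j \<in> I" "i \<noteq> j"
  shows indep_vars_integrable_mult: "integrable M (\<lambda>\<omega>. Z i \<omega> * Z j \<omega>)"
    and indep_vars_expectation_mult:
      "expectation (\<lambda>\<omega>. Z i \<omega> * Z j \<omega>) = expectation (Z i) * expectation (Z j)"
proof -
  have ind': "indep_vars (\<lambda>_. borel) Z {i, j}"
    by (rule indep_vars_subset[OF ind]) (use ij in auto)
  have int': "\<And>k. k \<in> {i, j} \<Longrightarrow> integrable M (Z k)"
    using int ij by auto
  show "integrable M (\<lambda>\<omega>. Z i \<omega> * Z j \<omega>)"
    using indep_vars_integrable[OF _ ind' int'] ij by simp
  show "expectation (\<lambda>\<omega>. Z i \<omega> * Z j \<omega>) = expectation (Z i) * expectation (Z j)"
    using indep_vars_lebesgue_integral[OF _ ind' int'] ij by simp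
qed

section \<open>Coordinates of a standard Gaussian vector\<close>

lemma (in prob_space)
  fixes Z :: "'a \<Rightarrow> real"
  assumes rv: "random_variable borel Z" and Z: "distr M borel Z = std_normal_distribution"
  shows integrable_std_normal_power: "integrable M (\<lambda>\<omega>. Z \<omega> ^ k)"
    and expectation_std_normal_power:
      "expectation (\<lambda>\<omega>. Z \<omega> ^ k) = (\<integral>x. x ^ k \<partial>std_normal_distribution)"
proof -
  show "integrable M (\<lambda>\<omega>. Z \<omega> ^ k)"
    using integrable_distr[of Z M borel "\<lambda>x. x ^ k"] rv Z
      integrable_std_normal_distribution_moment[of k] by simp
  show "expectation (\<lambda>\<omega>. Z \<omega> ^ k) = (\<integral>x. x ^ k \<partial>std_normal_distribution)"
    using integral_distr[of Z M borel "\<lambda>x. x ^ k"] rv Z by simp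
qed

lemma std_normal_second_fourth_moment:
  "(\<integral>x. x\<^sup>2 \<partial>std_normal_distribution) = 1" "(\<integral>x. x ^ 4 \<partial>std_normal_distribution) = 3"
  using std_normal_distribution_even_moments(1)[of 1] std_normal_distribution_even_moments(1)[of 2]
  by (simp_all add: fact_numeral)

text \<open>
  Both measures give a box \<open>Pi\<^sub>E I A\<close> the mass \<open>\<Prod>i\<in>I. \<integral>\<^sup>+x\<in>A i. f i x \<partial>M i\<close>: on the left by Fubini,
  since density and indicator of the box factor over the coordinates, and on the right by definition
  of the product. Boxes determine a product of sigma-finite measures.
\<close>

lemma density_PiM_prod:
  fixes f :: "'i \<Rightarrow> 'a \<Rightarrow> ennreal"
  assumes fin: "finite I"
    and M: "\<And>i. sigma_finite_measure (M i)"
    and N: "\<And>i. sigma_finite_measure (density (M i) (f i))"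
    and f [measurable]: "\<And>i. f i \<in> borel_measurable (M i)"
  shows "density (Pi\<^sub>M I M) (\<lambda>x. \<Prod>i\<in>I. f i (x i)) = Pi\<^sub>M I (\<lambda>i. density (M i) (f i))"
proof -
  interpret M: product_sigma_finite M by (simp add: product_sigma_finite_def M)
  interpret N: product_sigma_finite "\<lambda>i. density (M i) (f i)"
    by (simp add: product_sigma_finite_def N)
  show ?thesis
  proof (rule N.PiM_eqI[OF fin])
    show "sets (density (Pi\<^sub>M I M) (\<lambda>x. \<Prod>i\<in>I. f i (x i))) = sets (Pi\<^sub>M I (\<lambda>i. density (M i) (f i)))"
      by (simp cong: sets_PiM_cong)
    fix A assume "\<And>i. i \<in> I \<Longrightarrow> A i \<in> sets (density (M i) (f i))"
    then have A: "\<And>i. i \<in> I \<Longrightarrow> A i \<in> sets (M i)" by simp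
    have "emeasure (density (Pi\<^sub>M I M) (\<lambda>x. \<Prod>i\<in>I. f i (x i))) (Pi\<^sub>E I A)
        = (\<integral>\<^sup>+x. (\<Prod>i\<in>I. f i (x i)) * indicator (Pi\<^sub>E I A) x \<partial>Pi\<^sub>M I M)"
      using A fin by (intro emeasure_density) (auto intro!: sets_PiM_I_finite)
    also have "\<dots> = (\<integral>\<^sup>+x. (\<Prod>i\<in>I. f i (x i) * indicator (A i) (x i)) \<partial>Pi\<^sub>M I M)"
    proof (rule nn_integral_cong)
      fix x assume "x \<in> space (Pi\<^sub>M I M)"
      then have "indicator (Pi\<^sub>E I A) x = (\<Prod>i\<in>I. indicator (A i) (x i) :: ennreal)"
        using fin by (auto simp: indicator_def space_PiM PiE_iff)
      then show "(\<Prod>i\<in>I. f i (x i)) * indicator (Pi\<^sub>E I A) x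
          = (\<Prod>i\<in>I. f i (x i) * indicator (A i) (x i))"
        by (simp add: prod.distrib)
    qed
    also have "\<dots> = (\<Prod>i\<in>I. \<integral>\<^sup>+x. f i x * indicator (A i) x \<partial>M i)"
      using A by (intro M.product_nn_integral_prod[OF fin, of "\<lambda>i x. f i x * indicator (A i) x"]) auto
    also have "\<dots> = (\<Prod>i\<in>I. emeasure (density (M i) (f i)) (A i))"
      using A by (intro prod.cong refl) (simp add: emeasure_density)
    finally show "emeasure (density (Pi\<^sub>M I M) (\<lambda>x. \<Prod>i\<in>I. f i (x i))) (Pi\<^sub>E I A)
        = (\<Prod>i\<in>I. emeasure (density (M i) (f i)) (A i))" .
  qed
qed

lemma std_gaussian_density_eq_prod:
  "std_gaussian_density d x = (\<Prod>i<d. std_normal_density (x i))"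
proof -
  have sqrt_powr: "1 / sqrt (2 * pi) = (2 * pi) powr (- (1 / 2))"
    by (simp only: powr_minus_divide) (simp add: powr_half_sqrt)
  have "(\<Prod>i<d. std_normal_density (x i)) = (1 / sqrt (2 * pi)) ^ d * (\<Prod>i<d. exp (- (x i)\<^sup>2 / 2))"
    unfolding std_normal_density_def prod.distrib by simp
  also have "(\<Prod>i<d. exp (- (x i)\<^sup>2 / 2)) = exp (- (\<Sum>i<d. (x i)\<^sup>2) / 2)"
    by (simp only: exp_sum[symmetric] finite_lessThan sum_negf sum_divide_distrib[symmetric])
  also have "(1 / sqrt (2 * pi)) ^ d = (2 * pi) powr (- real d / 2)"
    unfolding sqrt_powr by (subst powr_power) auto
  finally show ?thesis
    by (simp add: std_gaussian_density_def L2_set_def sum_nonneg)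
qed

text \<open>
  The joint law of the coordinates is the product of standard normal laws, because the spherical
  density factors. Projecting this product gives the marginals, and a joint law equal to the
  product of its marginals is independence. The characterisation of independence by the joint law
  is about a nonempty family, hence \<open>d \<ge> 1\<close>.
\<close>

lemma (in prob_space) std_gaussian_coordinates:
  assumes X: "distributed M (lborel_pow d) X (\<lambda>x. ennreal (std_gaussian_density d x))"
    and d: "d \<ge> 1"
  shows "\<And>i. i < d \<Longrightarrow> random_variable borel (\<lambda>\<omega>. X \<omega> i)"
    and "\<And>i. i < d \<Longrightarrow> distr M borel (\<lambda>\<omega>. X \<omega> i) = std_normal_distribution"
    and "indep_vars (\<lambda>_. borel) (\<lambda>i \<omega>. X \<omega> i) {..<d}"
proof -
  let ?P = "\<Pi>\<^sub>M i\<in>{..<d}. (borel :: real measure)"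
  let ?N = "\<Pi>\<^sub>M i\<in>{..<d}. std_normal_distribution"
  have sets_eq: "sets (lborel_pow d) = sets ?P"
    unfolding lborel_pow_def by (intro sets_PiM_cong) auto
  have Xm [measurable]: "X \<in> measurable M ?P"
    using distributed_measurable[OF X] measurable_cong_sets[OF refl sets_eq] by blast
  show rv: "random_variable borel (\<lambda>\<omega>. X \<omega> i)" if "i < d" for i
    using that by (intro measurable_compose[OF Xm measurable_component_singleton]) simp
  have ps: "prob_space std_normal_distribution"
    by (simp add: prob_space_normal_density)
  have joint: "distr M ?P X = ?N"
  proof -
    have "distr M ?P X = distr M (lborel_pow d) X"
      by (intro distr_cong refl) (simp add: sets_eq)
    also have "\<dots> = density (lborel_pow d) (\<lambda>x. \<Prod>i<d. ennreal (std_normal_density (x i)))"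
      using distributed_distr_eq_density[OF X]
      by (simp add: std_gaussian_density_eq_prod prod_ennreal)
    also have "\<dots> = ?N"
      unfolding lborel_pow_def
      by (intro density_PiM_prod)
        (auto intro!: prob_space_imp_sigma_finite ps lborel.sigma_finite_measure_axioms)
    finally show ?thesis .
  qed
  show marg: "distr M borel (\<lambda>\<omega>. X \<omega> i) = std_normal_distribution" if "i < d" for i
  proof -
    have "distr M borel (\<lambda>\<omega>. X \<omega> i) = distr (distr M ?P X) borel (\<lambda>x. x i)"
      using that by (subst distr_distr) (auto simp: comp_def)
    also have "\<dots> = distr ?N std_normal_distribution (\<lambda>x. x i)"
      unfolding joint by (intro distr_cong refl) auto
    also have "\<dots> = std_normal_distribution"
      using that ps by (intro distr_PiM_component) auto
    finally show ?thesis .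
  qed
  \<comment> \<open>The values of \<open>X\<close> are extensional functions, so restricting them to the index set is harmless.\<close>
  have "distr M ?P (\<lambda>\<omega>. \<lambda>i\<in>{..<d}. X \<omega> i) = distr M ?P X"
  proof (intro distr_cong refl)
    fix \<omega> assume "\<omega> \<in> space M"
    then have "X \<omega> \<in> extensional {..<d}"
      using measurable_space[OF Xm] by (auto simp: space_PiM PiE_def)
    then show "(\<lambda>i\<in>{..<d}. X \<omega> i) = X \<omega>" by (rule extensional_restrict)
  qed
  also have "\<dots> = (\<Pi>\<^sub>M i\<in>{..<d}. distr M borel (\<lambda>\<omega>. X \<omega> i))"
    unfolding joint using marg by (intro PiM_cong) auto
  finally show "indep_vars (\<lambda>_. borel) (\<lambda>i \<omega>. X \<omega> i) {..<d}"
    using d rv by (subst indep_vars_iff_distr_eq_PiM') (auto simp: lessThan_empty_iff)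
qed

section \<open>Second moments of norm and inner product\<close>

text \<open>
  Off the diagonal, both expectations factor by independence into products of means, and
  \<open>E[X\<^sub>i] = 0\<close> and \<open>E[X\<^sub>i\<^sup>2 - 1] = 0\<close>. On the diagonal, \<open>E[X\<^sub>i\<^sup>2] = 1\<close>, and
  \<open>E[(X\<^sub>i\<^sup>2 - 1)\<^sup>2] = 3 - 2 + 1 = 2\<close> from the fourth moment \<open>3\<close>.
\<close>

lemma (in prob_space) std_gaussian_products:
  assumes X: "distributed M (lborel_pow d) X (\<lambda>x. ennreal (std_gaussian_density d x))"
    and ij: "i < d" "j < d"
  shows "integrable M (\<lambda>\<omega>. X \<omega> i * X \<omega> j)"
    and "expectation (\<lambda>\<omega>. X \<omega> i * X \<omega> j) = (if i = j then 1 else 0)"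
    and "integrable M (\<lambda>\<omega>. ((X \<omega> i)\<^sup>2 - 1) * ((X \<omega> j)\<^sup>2 - 1))"
    and "expectation (\<lambda>\<omega>. ((X \<omega> i)\<^sup>2 - 1) * ((X \<omega> j)\<^sup>2 - 1)) = (if i = j then 2 else 0)"
proof -
  have d: "d \<ge> 1" using ij by simp
  note rv = std_gaussian_coordinates(1)[OF X d]
  note distr = std_gaussian_coordinates(2)[OF X d]
  note ind = std_gaussian_coordinates(3)[OF X d]
  have int: "integrable M (\<lambda>\<omega>. X \<omega> k ^ n)" if "k < d" for k n
    using integrable_std_normal_power[OF rv distr] that by blast
  have E: "expectation (\<lambda>\<omega>. X \<omega> k ^ n) = (\<integral>x. x ^ n \<partial>std_normal_distribution)" if "k < d" for k n
    using expectation_std_normal_power[OF rv distr] that by blast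
  have int1: "integrable M (\<lambda>\<omega>. X \<omega> k)" and E1: "expectation (\<lambda>\<omega>. X \<omega> k) = 0" if "k < d" for k
    using int[OF that, of 1] E[OF that, of 1] integral_std_normal_distribution_moment_odd[of 1]
    by simp_all
  have int2: "integrable M (\<lambda>\<omega>. (X \<omega> k)\<^sup>2 - 1)"
    and E2: "expectation (\<lambda>\<omega>. (X \<omega> k)\<^sup>2 - 1) = 0" if "k < d" for k
    using int[OF that, of 2] E[OF that, of 2] std_normal_second_fourth_moment
    by (simp_all add: prob_space)
  have ind2: "indep_vars (\<lambda>_. borel) (\<lambda>k \<omega>. (X \<omega> k)\<^sup>2 - 1) {..<d}"
    by (rule indep_vars_compose2[OF ind]) simp
  have sq: "((X \<omega> k)\<^sup>2 - 1) * ((X \<omega> k)\<^sup>2 - 1) = X \<omega> k ^ 4 - 2 * (X \<omega> k)\<^sup>2 + 1" for \<omega> k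
    by algebra
  show "integrable M (\<lambda>\<omega>. X \<omega> i * X \<omega> j)"
    using indep_vars_integrable_mult[OF ind, of i j] int1 ij int[of i 2]
    by (cases "i = j") (auto simp: power2_eq_square)
  show "expectation (\<lambda>\<omega>. X \<omega> i * X \<omega> j) = (if i = j then 1 else 0)"
    using indep_vars_expectation_mult[OF ind, of i j] int1 E1 ij E[of i 2]
      std_normal_second_fourth_moment
    by (cases "i = j") (auto simp: power2_eq_square)
  show "integrable M (\<lambda>\<omega>. ((X \<omega> i)\<^sup>2 - 1) * ((X \<omega> j)\<^sup>2 - 1))"
    using indep_vars_integrable_mult[OF ind2, of i j] int2 ij int[of i 2] int[of i 4]
    by (cases "i = j") (auto simp: sq)
  show "expectation (\<lambda>\<omega>. ((X \<omega> i)\<^sup>2 - 1) * ((X \<omega> j)\<^sup>2 - 1)) = (if i = j then 2 else 0)"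
  proof (cases "i = j")
    case True
    then show ?thesis
      using int[of i 2] int[of i 4] E[of i 2] E[of i 4] ij std_normal_second_fourth_moment
      by (simp add: sq prob_space)
  next
    case False
    then show ?thesis
      using indep_vars_expectation_mult[OF ind2, of i j] int2 E2 ij by simp
  qed
qed

lemma (in prob_space)
  assumes X: "distributed M (lborel_pow d) X (\<lambda>x. ennreal (std_gaussian_density d x))"
  shows integrable_std_gaussian_norm_sq: "integrable M (\<lambda>\<omega>. (\<Sum>i<d. (X \<omega> i)\<^sup>2 - 1)\<^sup>2)"
    and expectation_std_gaussian_norm_sq:
      "expectation (\<lambda>\<omega>. (\<Sum>i<d. (X \<omega> i)\<^sup>2 - 1)\<^sup>2) = 2 * real d"
proof -
  let ?W = "\<lambda>i \<omega>. (X \<omega> i)\<^sup>2 - 1"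
  have W: "integrable M (\<lambda>\<omega>. ?W i \<omega> * ?W j \<omega>)"
      "expectation (\<lambda>\<omega>. ?W i \<omega> * ?W j \<omega>) = (if i = j then 2 else 0)"
    if "i \<in> {..<d}" "j \<in> {..<d}" for i j
    using std_gaussian_products(3,4)[OF X] that by auto
  show "integrable M (\<lambda>\<omega>. (\<Sum>i<d. ?W i \<omega>)\<^sup>2)"
    by (rule second_moment_sum_orthogonal(1)) (simp_all add: W)
  have "expectation (\<lambda>\<omega>. (\<Sum>i<d. ?W i \<omega>)\<^sup>2) = (\<Sum>i<d. expectation (\<lambda>\<omega>. (?W i \<omega>)\<^sup>2))"
    by (rule second_moment_sum_orthogonal(2)) (simp_all add: W)
  also have "\<dots> = (\<Sum>i<d. 2)"
    by (intro sum.cong refl) (use W in \<open>auto simp: power2_eq_square\<close>)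
  finally show "expectation (\<lambda>\<omega>. (\<Sum>i<d. ?W i \<omega>)\<^sup>2) = 2 * real d" by simp
qed

text \<open>
  The terms \<open>X\<^sub>iY\<^sub>i\<close> are orthonormal: in \<open>(X\<^sub>iY\<^sub>i)(X\<^sub>jY\<^sub>j) = (X\<^sub>iX\<^sub>j)(Y\<^sub>iY\<^sub>j)\<close> the two factors on the right
  are independent and both have mean \<open>\<delta>\<^sub>i\<^sub>j\<close>. Grouping them this way needs only the independence of
  the two vectors, not the joint independence of all \<open>2d\<close> coordinates.
\<close>

lemma (in prob_space)
  assumes X: "distributed M (lborel_pow d) X (\<lambda>x. ennreal (std_gaussian_density d x))"
    and Y: "distributed M (lborel_pow d) Y (\<lambda>x. ennreal (std_gaussian_density d x))"
    and XY: "indep_var (lborel_pow d) X (lborel_pow d) Y"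
  shows integrable_std_gaussian_inner: "integrable M (\<lambda>\<omega>. (\<Sum>i<d. X \<omega> i * Y \<omega> i)\<^sup>2)"
    and expectation_std_gaussian_inner: "expectation (\<lambda>\<omega>. (\<Sum>i<d. X \<omega> i * Y \<omega> i)\<^sup>2) = real d"
proof -
  let ?W = "\<lambda>i \<omega>. X \<omega> i * Y \<omega> i"
  have W: "integrable M (\<lambda>\<omega>. ?W i \<omega> * ?W j \<omega>)"
      "expectation (\<lambda>\<omega>. ?W i \<omega> * ?W j \<omega>) = (if i = j then 1 else 0)"
    if ij: "i \<in> {..<d}" "j \<in> {..<d}" for i j
  proof -
    have m: "(\<lambda>x. x i * x j) \<in> borel_measurable (lborel_pow d)"
      unfolding lborel_pow_def using ij by measurable
    have ind: "indep_var borel (\<lambda>\<omega>. X \<omega> i * X \<omega> j) borel (\<lambda>\<omega>. Y \<omega> i * Y \<omega> j)"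
      using indep_var_compose[OF XY m m] by (simp add: comp_def)
    have reorder: "?W i \<omega> * ?W j \<omega> = (X \<omega> i * X \<omega> j) * (Y \<omega> i * Y \<omega> j)" for \<omega>
      by simp
    note intX = std_gaussian_products(1)[OF X, of i j] and intY = std_gaussian_products(1)[OF Y, of i j]
    show "integrable M (\<lambda>\<omega>. ?W i \<omega> * ?W j \<omega>)"
      unfolding reorder using indep_var_integrable[OF ind] intX intY ij by simp
    show "expectation (\<lambda>\<omega>. ?W i \<omega> * ?W j \<omega>) = (if i = j then 1 else 0)"
      unfolding reorder using indep_var_lebesgue_integral[OF ind] intX intY ij
        std_gaussian_products(2)[OF X, of i j] std_gaussian_products(2)[OF Y, of i j] by simp
  qed
  show "integrable M (\<lambda>\<omega>. (\<Sum>i<d. ?W i \<omega>)\<^sup>2)"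
    by (rule second_moment_sum_orthogonal(1)) (simp_all add: W)
  have "expectation (\<lambda>\<omega>. (\<Sum>i<d. ?W i \<omega>)\<^sup>2) = (\<Sum>i<d. expectation (\<lambda>\<omega>. (?W i \<omega>)\<^sup>2))"
    by (rule second_moment_sum_orthogonal(2)) (simp_all add: W)
  also have "\<dots> = (\<Sum>i<d. 1)"
    by (intro sum.cong refl) (use W in \<open>auto simp: power2_eq_square\<close>)
  finally show "expectation (\<lambda>\<omega>. (\<Sum>i<d. ?W i \<omega>)\<^sup>2) = real d" by simp
qed

section \<open>Concentration of the distance\<close>

lemma (in prob_space) std_gaussian_distance_sq_second_moment:
  assumes X: "distributed M (lborel_pow d) X (\<lambda>x. ennreal (std_gaussian_density d x))"
    and Y: "distributed M (lborel_pow d) Y (\<lambda>x. ennreal (std_gaussian_density d x))"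
    and XY: "indep_var (lborel_pow d) X (lborel_pow d) Y"
    and d: "d \<ge> 1"
  defines "D \<equiv> \<lambda>\<omega>. (L2_set (\<lambda>i. X \<omega> i - Y \<omega> i) {..<d})\<^sup>2 - 2 * real d"
  shows "random_variable borel D"
    and "integrable M (\<lambda>\<omega>. (D \<omega>)\<^sup>2)"
    and "expectation (\<lambda>\<omega>. (D \<omega>)\<^sup>2) \<le> 24 * real d"
proof -
  define A where "A = (\<lambda>\<omega>. \<Sum>i<d. (X \<omega> i)\<^sup>2 - 1)"
  define B where "B = (\<lambda>\<omega>. \<Sum>i<d. (Y \<omega> i)\<^sup>2 - 1)"
  define C where "C = (\<lambda>\<omega>. \<Sum>i<d. X \<omega> i * Y \<omega> i)"
  have intA: "integrable M (\<lambda>\<omega>. (A \<omega>)\<^sup>2)" and EA: "expectation (\<lambda>\<omega>. (A \<omega>)\<^sup>2) = 2 * real d"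
    and intB: "integrable M (\<lambda>\<omega>. (B \<omega>)\<^sup>2)" and EB: "expectation (\<lambda>\<omega>. (B \<omega>)\<^sup>2) = 2 * real d"
    and intC: "integrable M (\<lambda>\<omega>. (C \<omega>)\<^sup>2)" and EC: "expectation (\<lambda>\<omega>. (C \<omega>)\<^sup>2) = real d"
    unfolding A_def B_def C_def
    using integrable_std_gaussian_norm_sq[OF X] expectation_std_gaussian_norm_sq[OF X]
      integrable_std_gaussian_norm_sq[OF Y] expectation_std_gaussian_norm_sq[OF Y]
      integrable_std_gaussian_inner[OF X Y XY] expectation_std_gaussian_inner[OF X Y XY]
    by auto
  have D_eq: "D \<omega> = A \<omega> + B \<omega> - 2 * C \<omega>" for \<omega>
  proof -
    have "D \<omega> = (\<Sum>i<d. (X \<omega> i - Y \<omega> i)\<^sup>2) - 2 * real d"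
      by (simp add: D_def L2_set_def sum_nonneg)
    then show ?thesis
      by (simp add: A_def B_def C_def power2_diff sum.distrib sum_subtractf sum_distrib_left
          mult.assoc)
  qed
  show meas [measurable]: "random_variable borel D"
    unfolding D_eq A_def B_def C_def
    using std_gaussian_coordinates(1)[OF X d] std_gaussian_coordinates(1)[OF Y d]
    by (intro borel_measurable_add borel_measurable_diff borel_measurable_times
        borel_measurable_sum borel_measurable_power borel_measurable_const) auto
  have bound: "(D \<omega>)\<^sup>2 \<le> 3 * (A \<omega>)\<^sup>2 + 3 * (B \<omega>)\<^sup>2 + 12 * (C \<omega>)\<^sup>2" for \<omega>
  proof -
    \<comment> \<open>These squares sum to \<open>3(a\<^sup>2 + b\<^sup>2 + c\<^sup>2) - (a + b + c)\<^sup>2\<close> for \<open>a = A\<close>, \<open>b = B\<close>, \<open>c = -2C\<close>.\<close>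
    have "0 \<le> (A \<omega> - B \<omega>)\<^sup>2 + (A \<omega> + 2 * C \<omega>)\<^sup>2 + (B \<omega> + 2 * C \<omega>)\<^sup>2" by simp
    then show ?thesis
      unfolding D_eq by (simp add: power2_eq_square algebra_simps)
  qed
  have intR: "integrable M (\<lambda>\<omega>. 3 * (A \<omega>)\<^sup>2 + 3 * (B \<omega>)\<^sup>2 + 12 * (C \<omega>)\<^sup>2)"
    using intA intB intC by auto
  show intD: "integrable M (\<lambda>\<omega>. (D \<omega>)\<^sup>2)"
    by (rule Bochner_Integration.integrable_bound[OF intR]) (use bound in auto)
  have "expectation (\<lambda>\<omega>. (D \<omega>)\<^sup>2)
      \<le> expectation (\<lambda>\<omega>. 3 * (A \<omega>)\<^sup>2 + 3 * (B \<omega>)\<^sup>2 + 12 * (C \<omega>)\<^sup>2)"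
    by (intro integral_mono intD intR bound)
  also have "\<dots> = 24 * real d"
    using intA intB intC by (simp add: EA EB EC)
  finally show "expectation (\<lambda>\<omega>. (D \<omega>)\<^sup>2) \<le> 24 * real d" .
qed

text \<open>
  Passing from the distance to its square gains the factor \<open>s = \<surd>(2d)\<close> in the deviation, which
  exactly offsets the growth of the second moment with \<open>d\<close>.
\<close>

lemma std_gaussian_distance_concentration:
  assumes G: "indep_std_gaussians M d X Y" and d: "d \<ge> 1" and e: "\<epsilon> > 0"
  shows "\<P>(\<omega> in M. \<bar>L2_set (\<lambda>i. X \<omega> i - Y \<omega> i) {..<d} - sqrt (2 * real d)\<bar> \<ge> \<epsilon>) \<le> 12 / \<epsilon>\<^sup>2"
proof -
  interpret prob_space M using G by (simp add: indep_std_gaussians_def)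
  have X: "distributed M (lborel_pow d) X (\<lambda>x. ennreal (std_gaussian_density d x))"
    and Y: "distributed M (lborel_pow d) Y (\<lambda>x. ennreal (std_gaussian_density d x))"
    and XY: "indep_var (lborel_pow d) X (lborel_pow d) Y"
    using G by (auto simp: indep_std_gaussians_def)
  define R where "R \<omega> = L2_set (\<lambda>i. X \<omega> i - Y \<omega> i) {..<d}" for \<omega>
  define D where "D \<omega> = (R \<omega>)\<^sup>2 - 2 * real d" for \<omega>
  define s where "s = sqrt (2 * real d)"
  have s: "s > 0" "s\<^sup>2 = 2 * real d" using d by (auto simp: s_def)
  note D = std_gaussian_distance_sq_second_moment[OF X Y XY d, folded R_def, folded D_def]
  note [measurable] = D(1)
  have le: "\<epsilon> * s \<le> \<bar>D \<omega>\<bar>" if "\<epsilon> \<le> \<bar>R \<omega> - s\<bar>" for \<omega>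
  proof -
    have "D \<omega> = (R \<omega> - s) * (R \<omega> + s)"
      unfolding D_def s(2)[symmetric] by (simp add: power2_eq_square algebra_simps)
    moreover have "R \<omega> \<ge> 0" by (simp add: R_def L2_set_nonneg)
    ultimately show ?thesis
      using that s(1) e by (auto simp: abs_mult intro!: mult_mono)
  qed
  have "prob {\<omega> \<in> space M. \<epsilon> \<le> \<bar>R \<omega> - s\<bar>} \<le> prob {\<omega> \<in> space M. \<epsilon> * s \<le> \<bar>D \<omega>\<bar>}"
    using le by (intro finite_measure_mono) auto
  also have "\<dots> \<le> expectation (\<lambda>\<omega>. (D \<omega>)\<^sup>2) / (\<epsilon> * s)\<^sup>2"
    using e s(1) by (intro second_moment_method D) auto
  also have "\<dots> \<le> 24 * real d / (\<epsilon> * s)\<^sup>2"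
    using D(3) by (rule divide_right_mono) simp
  also have "\<dots> = 12 / \<epsilon>\<^sup>2"
    using d e by (simp add: power_mult_distrib s(2) field_simps)
  finally show ?thesis by (simp add: R_def s_def)
qed

theorem theorem4p12:
  shows "(\<forall>\<epsilon>::real. \<epsilon> > 18 \<longrightarrow>
            (\<exists>d\<^sub>0::nat. \<forall>d\<ge>d\<^sub>0. d \<ge> 1 \<longrightarrow>
              (\<forall>(M :: 'a measure) X Y. indep_std_gaussians M d X Y \<longrightarrow>
                \<P>(\<omega> in M. \<bar>L2_set (\<lambda>i. X \<omega> i - Y \<omega> i) {..<d} - sqrt (2 * real d)\<bar> \<ge> \<epsilon>)
                  \<le> 18 / \<epsilon>)))
       \<and> (\<forall>\<epsilon>::real. \<epsilon> > 18 \<longrightarrow>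
            (\<forall>d::nat. d \<ge> 1 \<longrightarrow> real d \<ge> \<epsilon>\<^sup>2 \<longrightarrow>
              (\<forall>(M :: 'a measure) X Y. indep_std_gaussians M d X Y \<longrightarrow>
                \<P>(\<omega> in M. \<bar>L2_set (\<lambda>i. X \<omega> i - Y \<omega> i) {..<d} - sqrt (2 * real d)\<bar> \<ge> \<epsilon>)
                  \<le> 18 / \<epsilon> + 8 / sqrt (real d))))"
proof -
  have bound: "\<P>(\<omega> in M. \<bar>L2_set (\<lambda>i. X \<omega> i - Y \<omega> i) {..<d} - sqrt (2 * real d)\<bar> \<ge> \<epsilon>) \<le> 18 / \<epsilon>"
    if "indep_std_gaussians M d X Y" "d \<ge> 1" "\<epsilon> > 18"
    for M :: "'a measure" and d X Y and \<epsilon> :: real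
  proof -
    have "\<P>(\<omega> in M. \<bar>L2_set (\<lambda>i. X \<omega> i - Y \<omega> i) {..<d} - sqrt (2 * real d)\<bar> \<ge> \<epsilon>) \<le> 12 / \<epsilon>\<^sup>2"
      using that by (intro std_gaussian_distance_concentration) auto
    also have "\<dots> \<le> 18 / \<epsilon>"
      using that(3) by (simp add: field_simps power2_eq_square)
    finally show ?thesis .
  qed
  have weaken: "18 / \<epsilon> \<le> 18 / \<epsilon> + 8 / sqrt (real d)" for \<epsilon> :: real and d :: nat
    by simp
  show ?thesis
    by (intro conjI allI impI exI[of _ 0] bound order_trans[OF bound weaken])
qed

end
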